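(* Let $q\in[-1,0)\cup(0,1]$, let $A_q$ be the $C^*$-algebra of the quantum $4$-sphere $S^4_q$ with generators $\alpha,\beta,z$, let $\bar A_q=A_q/\mathbb C\,\mathbb I$, and let $$e=\frac12\begin{pmatrix} 1+z & 0 & \alpha & \beta\\ 0 & 1+z & -q\beta^* & \alpha^*\\ \alpha^* & -q\beta & 1-z & 0\\ \beta^* & \alpha & 0 & 1-z\end{pmatrix}\in \mathrm{Mat}_4(A_q).$$ Then the components of the reduced Chern-Connes character of $e$ satisfy $$b\,ch_1(e)=0=B\,ch_0(e),$$ $$b\,ch_2(e)=\tfrac1{16}(1-q^2)\Big\{\mathbb I\otimes z\otimes(\beta\otimes\beta^*-\beta^*\otimes\beta)+\mathbb I\otimes\beta\otimes(\beta^*\otimes z-z\otimes\beta^* )+\mathbb I\otimes\beta^*\otimes(z\otimes\beta-\beta\otimes z)\Big\},$$ and this last expression is exactly equal to $B\,ch_1(e)$. Thus the couple $(ch_1(e),ch_2(e))$ defines a cycle in the $(b,B)$ bicomplex of cyclic homology.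
   Context: For $q\in[-1,0)\cup(0,1]$, $A_q$ is the universal unital $C^*$-algebra (unit $\mathbb I$, also written $1$) generated by three elements $\alpha,\beta,z$ subject to the relations $$\beta\alpha=q\alpha\beta,\quad \beta^*\alpha=q\alpha\beta^*,\quad \beta\beta^*=\beta^*\beta,$$ $$z=z^*,\quad z\alpha=\alpha z,\quad z\beta=\beta z,$$ $$\alpha^*\alpha+q^2\beta^*\beta+z^2=\mathbb I,\qquad \alpha\alpha^*+\beta\beta^*+z^2=\mathbb I.$$ The element $e$ is a selfadjoint idempotent, $e^2=e=e^*$. $\bar A_q=A_q/\mathbb C\,\mathbb I$ is the quotient of $A_q$ by the scalar multiples of the unit; elements of $A_q$ appearing in any tensor slot other than the first are taken modulo multiples of $\mathbb I$, i.e. denote their classes in $\bar A_q$. For $n\ge0$, up to normalization, the components of the reduced Chern-Connes character are $$ch_n(e)=\Big\langle\big(e-\tfrac12\big)\otimes\underbrace{e\otimes\cdots\otimes e}_{2n}\Big\rangle\in A_q\otimes\bar A_q^{\otimes 2n},$$ where $\langle\ \rangle$ is the projection on the commutant of the $4\times4$ matrices, taken here in the form $$\langle M_0\otimes\cdots\otimes M_m\rangle=\sum_{i_0,\dots,i_m=1}^4 (M_0)_{i_0i_1}\otimes(M_1)_{i_1i_2}\otimes\cdots\otimes(M_m)_{i_mi_0},\qquad M_j\in\mathrm{Mat}_4(A_q)$$ (for $m=0$ this is the trace of $M_0$). In particular $ch_0(e)=0$ and $$ch_1(e)=\tfrac18(1-q^2)\Big\{z\otimes(\beta\otimes\beta^*-\beta^*\otimes\beta)+\beta^*\otimes(z\otimes\beta-\beta\otimes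 z)+\beta\otimes(\beta^*\otimes z-z\otimes\beta^* )\Big\}.$$ The operator $b$ is $$b(a_0\otimes\cdots\otimes a_m)=\sum_{j=0}^{m-1}(-1)^j a_0\otimes\cdots\otimes a_ja_{j+1}\otimes\cdots\otimes a_m+(-1)^m a_ma_0\otimes a_1\otimes\cdots\otimes a_{m-1},$$ and the operator $B$ is $B=AB_0$, where $$B_0(a_0\otimes a_1\otimes\cdots\otimes a_m)=\mathbb I\otimes a_0\otimes a_1\otimes\cdots\otimes a_m,$$ $$A(a_0\otimes a_1\otimes\cdots\otimes a_m)=\frac1m\sum_{j=0}^m(-1)^{mj}a_j\otimes a_{j+1}\otimes\cdots\otimes a_{j-1},$$ with the cyclic identification $m+1=0$.
   Formalization: The factor 1/m in A is read with m the degree of the chain to which B is applied (1 in degree 0), not the degree of A's own argument; with the latter, B ch_1(e) would carry 1/24 instead of 1/16 and could not equal b ch_2(e) for q^2≠1. *)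

theory Defs
  imports "HOL-Analysis.Analysis" "HOL-Library.Poly_Mapping" "HOL-Algebra.Ring"
begin

section \<open>Complex vector spaces and unital C*-algebras\<close>

class complex_vector = ab_group_add +
  fixes scaleC :: "complex \<Rightarrow> 'a \<Rightarrow> 'a"  (infixr "*\<^sub>C" 75)
  assumes scaleC_add_right: "c *\<^sub>C (x + y) = c *\<^sub>C x + c *\<^sub>C y"
    and scaleC_add_left: "(c + d) *\<^sub>C x = c *\<^sub>C x + d *\<^sub>C x"
    and scaleC_scaleC [simp]: "c *\<^sub>C d *\<^sub>C x = (c * d) *\<^sub>C x"
    and scaleC_one [simp]: "1 *\<^sub>C x = x"
begin

lemma scaleC_zero_left [simp]: "0 *\<^sub>C x = 0"
  using scaleC_add_left[of 0 0 x] by simp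

lemma scaleC_zero_right [simp]: "c *\<^sub>C 0 = 0"
  using scaleC_add_right[of c 0 0] by simp

lemma scaleC_minus_left [simp]: "(- c) *\<^sub>C x = - (c *\<^sub>C x)"
  using scaleC_add_left[of c "- c" x] by (simp add: minus_unique)

lemma scaleC_minus_right [simp]: "c *\<^sub>C (- x) = - (c *\<^sub>C x)"
  using scaleC_add_right[of c x "- x"] by (simp add: minus_unique)

lemma scaleC_diff_right: "c *\<^sub>C (x - y) = c *\<^sub>C x - c *\<^sub>C y"
  using scaleC_add_right[of c x "- y"] by simp

lemma scaleC_sum_right: "c *\<^sub>C (\<Sum>i\<in>I. f i) = (\<Sum>i\<in>I. c *\<^sub>C f i)"
  by (induction I rule: infinite_finite_induct) (simp_all add: scaleC_add_right)

end

instantiation complex :: complex_vector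
begin
definition scaleC_complex :: "complex \<Rightarrow> complex \<Rightarrow> complex"
  where "scaleC_complex = (*)"
instance by standard (simp_all add: scaleC_complex_def algebra_simps)
end

instantiation poly_mapping :: (type, complex_vector) complex_vector
begin
definition scaleC_poly_mapping :: "complex \<Rightarrow> ('a \<Rightarrow>\<^sub>0 'b) \<Rightarrow> ('a \<Rightarrow>\<^sub>0 'b)"
  where "scaleC_poly_mapping c = Poly_Mapping.map (scaleC c)"

lemma lookup_scaleC [simp]:
  "Poly_Mapping.lookup (c *\<^sub>C p) k = c *\<^sub>C Poly_Mapping.lookup p k"
  unfolding scaleC_poly_mapping_def Poly_Mapping.map.rep_eq
  by (cases "Poly_Mapping.lookup p k = 0") simp_all

instance
  by standard (simp_all add: poly_mapping_eq_iff fun_eq_iff lookup_add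
    scaleC_add_right scaleC_add_left)
end

class cstar_algebra = real_normed_algebra_1 + complete_space + complex_vector +
  fixes star :: "'a \<Rightarrow> 'a"
  assumes scaleR_scaleC: "r *\<^sub>R x = complex_of_real r *\<^sub>C x"
    and scaleC_mult_left: "(c *\<^sub>C x) * y = c *\<^sub>C (x * y)"
    and scaleC_mult_right: "x * (c *\<^sub>C y) = c *\<^sub>C (x * y)"
    and norm_scaleC: "norm (c *\<^sub>C x) = cmod c * norm x"
    and star_star: "star (star x) = x"
    and star_add: "star (x + y) = star x + star y"
    and star_scaleC: "star (c *\<^sub>C x) = cnj c *\<^sub>C star x"
    and star_mult: "star (x * y) = star y * star x"
    and cstar_identity: "norm (star x * x) = (norm x)\<^sup>2"

section \<open>The quantum sphere as a universal C*-algebra\<close>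

text \<open>A universal property quantifies over all C*-algebras, which a type class cannot do inside
  a formula. Its target algebras are therefore C*-algebras on a carrier set.\<close>

record 'b cstar_struct = "'b ring" +
  cscale :: "complex \<Rightarrow> 'b \<Rightarrow> 'b"
  cadj :: "'b \<Rightarrow> 'b"
  cnorm :: "'b \<Rightarrow> real"

locale cstar_on = ring B for B :: "('b, 'm) cstar_struct_scheme" (structure) +
  assumes cscale_closed: "x \<in> carrier B \<Longrightarrow> cscale B c x \<in> carrier B"
    and cscale_add_right: "\<lbrakk>x \<in> carrier B; y \<in> carrier B\<rbrakk> \<Longrightarrow>
      cscale B c (x \<oplus> y) = cscale B c x \<oplus> cscale B c y"
    and cscale_add_left: "x \<in> carrier B \<Longrightarrow>
      cscale B (c + d) x = cscale B c x \<oplus> cscale B d x"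
    and cscale_cscale: "x \<in> carrier B \<Longrightarrow> cscale B c (cscale B d x) = cscale B (c * d) x"
    and cscale_one: "x \<in> carrier B \<Longrightarrow> cscale B 1 x = x"
    and cscale_mult_left: "\<lbrakk>x \<in> carrier B; y \<in> carrier B\<rbrakk> \<Longrightarrow>
      cscale B c x \<otimes> y = cscale B c (x \<otimes> y)"
    and cscale_mult_right: "\<lbrakk>x \<in> carrier B; y \<in> carrier B\<rbrakk> \<Longrightarrow>
      x \<otimes> cscale B c y = cscale B c (x \<otimes> y)"
    and cadj_closed: "x \<in> carrier B \<Longrightarrow> cadj B x \<in> carrier B"
    and cadj_cadj: "x \<in> carrier B \<Longrightarrow> cadj B (cadj B x) = x"
    and cadj_add: "\<lbrakk>x \<in> carrier B; y \<in> carrier B\<rbrakk> \<Longrightarrow>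
      cadj B (x \<oplus> y) = cadj B x \<oplus> cadj B y"
    and cadj_cscale: "x \<in> carrier B \<Longrightarrow> cadj B (cscale B c x) = cscale B (cnj c) (cadj B x)"
    and cadj_mult: "\<lbrakk>x \<in> carrier B; y \<in> carrier B\<rbrakk> \<Longrightarrow>
      cadj B (x \<otimes> y) = cadj B y \<otimes> cadj B x"
    and cnorm_eq_0: "x \<in> carrier B \<Longrightarrow> cnorm B x = 0 \<longleftrightarrow> x = \<zero>"
    and cnorm_triangle: "\<lbrakk>x \<in> carrier B; y \<in> carrier B\<rbrakk> \<Longrightarrow>
      cnorm B (x \<oplus> y) \<le> cnorm B x + cnorm B y"
    and cnorm_cscale: "x \<in> carrier B \<Longrightarrow> cnorm B (cscale B c x) = cmod c * cnorm B x"
    and cnorm_mult: "\<lbrakk>x \<in> carrier B; y \<in> carrier B\<rbrakk> \<Longrightarrow>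
      cnorm B (x \<otimes> y) \<le> cnorm B x * cnorm B y"
    and cnorm_cstar: "x \<in> carrier B \<Longrightarrow> cnorm B (cadj B x \<otimes> x) = (cnorm B x)\<^sup>2"
    and cnorm_complete:
      "\<lbrakk>\<And>n. X n \<in> carrier B;
        \<And>\<epsilon>. \<epsilon> > 0 \<Longrightarrow> \<exists>N. \<forall>m\<ge>N. \<forall>n\<ge>N. cnorm B (X m \<ominus> X n) < \<epsilon>\<rbrakk> \<Longrightarrow>
       \<exists>L\<in>carrier B. (\<lambda>n. cnorm B (X n \<ominus> L)) \<longlonglongrightarrow> 0"

definition sphere_relations :: "real \<Rightarrow> 'a::cstar_algebra \<Rightarrow> 'a \<Rightarrow> 'a \<Rightarrow> bool" where
  "sphere_relations q \<alpha> \<beta> z \<longleftrightarrow>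
     \<beta> * \<alpha> = q *\<^sub>R (\<alpha> * \<beta>) \<and>
     star \<beta> * \<alpha> = q *\<^sub>R (\<alpha> * star \<beta>) \<and>
     \<beta> * star \<beta> = star \<beta> * \<beta> \<and>
     z = star z \<and> z * \<alpha> = \<alpha> * z \<and> z * \<beta> = \<beta> * z \<and>
     star \<alpha> * \<alpha> + q\<^sup>2 *\<^sub>R (star \<beta> * \<beta>) + z\<^sup>2 = 1 \<and>
     \<alpha> * star \<alpha> + \<beta> * star \<beta> + z\<^sup>2 = 1"

definition sphere_relations_in ::
    "('b, 'm) cstar_struct_scheme \<Rightarrow> real \<Rightarrow> 'b \<Rightarrow> 'b \<Rightarrow> 'b \<Rightarrow> bool" where
  "sphere_relations_in B q a b z \<longleftrightarrow>
     b \<otimes>\<^bsub>B\<^esub> a = cscale B q (a \<otimes>\<^bsub>B\<^esub> b) \<and>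
     cadj B b \<otimes>\<^bsub>B\<^esub> a = cscale B q (a \<otimes>\<^bsub>B\<^esub> cadj B b) \<and>
     b \<otimes>\<^bsub>B\<^esub> cadj B b = cadj B b \<otimes>\<^bsub>B\<^esub> b \<and>
     z = cadj B z \<and> z \<otimes>\<^bsub>B\<^esub> a = a \<otimes>\<^bsub>B\<^esub> z \<and> z \<otimes>\<^bsub>B\<^esub> b = b \<otimes>\<^bsub>B\<^esub> z \<and>
     cadj B a \<otimes>\<^bsub>B\<^esub> a \<oplus>\<^bsub>B\<^esub> cscale B (q\<^sup>2) (cadj B b \<otimes>\<^bsub>B\<^esub> b) \<oplus>\<^bsub>B\<^esub> z \<otimes>\<^bsub>B\<^esub> z = \<one>\<^bsub>B\<^esub> \<and>
     a \<otimes>\<^bsub>B\<^esub> cadj B a \<oplus>\<^bsub>B\<^esub> b \<otimes>\<^bsub>B\<^esub> cadj B b \<oplus>\<^bsub>B\<^esub> z \<otimes>\<^bsub>B\<^esub> z = \<one>\<^bsub>B\<^esub>"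

definition unital_star_hom ::
    "('a::cstar_algebra \<Rightarrow> 'b) \<Rightarrow> ('b, 'm) cstar_struct_scheme \<Rightarrow> bool" where
  "unital_star_hom \<phi> B \<longleftrightarrow>
     range \<phi> \<subseteq> carrier B \<and> \<phi> 1 = \<one>\<^bsub>B\<^esub> \<and>
     (\<forall>x y. \<phi> (x + y) = \<phi> x \<oplus>\<^bsub>B\<^esub> \<phi> y \<and> \<phi> (x * y) = \<phi> x \<otimes>\<^bsub>B\<^esub> \<phi> y) \<and>
     (\<forall>c x. \<phi> (c *\<^sub>C x) = cscale B c (\<phi> x)) \<and>
     (\<forall>x. \<phi> (star x) = cadj B (\<phi> x))"

definition cstar_subalgebra :: "'a::cstar_algebra set \<Rightarrow> bool" where
  "cstar_subalgebra S \<longleftrightarrow> closed S \<and> 1 \<in> S \<and>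
     (\<forall>x\<in>S. \<forall>y\<in>S. x + y \<in> S \<and> x * y \<in> S) \<and>
     (\<forall>x\<in>S. star x \<in> S \<and> (\<forall>c. c *\<^sub>C x \<in> S))"

text \<open>The type \<open>'a\<close> with the elements \<open>\<alpha>, \<beta>, z\<close> is the universal unital C*-algebra with these
  generators and relations. Targets on subsets of the reals suffice: a homomorphism sees only the
  C*-subalgebra generated by three elements, which is separable and hence has at most continuum
  many elements, so it has an isomorphic copy of this kind.\<close>

definition universal_sphere_algebra :: "real \<Rightarrow> 'a::cstar_algebra \<Rightarrow> 'a \<Rightarrow> 'a \<Rightarrow> bool" where
  "universal_sphere_algebra q \<alpha> \<beta> z \<longleftrightarrow>
     sphere_relations q \<alpha> \<beta> z \<and>
     (\<forall>S. cstar_subalgebra S \<and> \<alpha> \<in> S \<and> \<beta> \<in> S \<and> z \<in> S \<longrightarrow> S = UNIV) \<and>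
     (\<forall>(B :: real cstar_struct) a' b' z'.
        cstar_on B \<and> a' \<in> carrier B \<and> b' \<in> carrier B \<and> z' \<in> carrier B \<and>
        sphere_relations_in B q a' b' z' \<longrightarrow>
        (\<exists>!\<phi> :: 'a \<Rightarrow> real. unital_star_hom \<phi> B \<and> \<phi> \<alpha> = a' \<and> \<phi> \<beta> = b' \<and> \<phi> z = z'))"

section \<open>Reduced chains\<close>

text \<open>Write \<open>A\<close> for the algebra and \<open>A'\<close> for its quotient by the scalar multiples of \<open>1\<close>. A
  multilinear map on \<open>A \<times> A' \<times> \<dots> \<times> A'\<close> is a multilinear map on \<open>A \<times> \<dots> \<times> A\<close> that vanishes whenever
  some entry other than the first is \<open>1\<close>. So the free vector space on lists of length \<open>m + 1\<close> modulo
  the following relations is the algebraic tensor product of \<open>A\<close> with \<open>m\<close> copies of \<open>A'\<close>. The type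
  \<open>red_chain\<close> is the direct sum of these spaces over all \<open>m\<close> (and an unused summand spanned by the
  empty list).\<close>

inductive_set null_chains :: "('a::cstar_algebra list \<Rightarrow>\<^sub>0 complex) set" where
  zero: "0 \<in> null_chains"
| lincomb: "\<lbrakk>p \<in> null_chains; r \<in> null_chains\<rbrakk> \<Longrightarrow> c *\<^sub>C p + r \<in> null_chains"
| additive: "i < length xs \<Longrightarrow>
    Poly_Mapping.single (xs[i := x + y]) 1 - Poly_Mapping.single (xs[i := x]) 1
      - Poly_Mapping.single (xs[i := y]) 1 \<in> null_chains"
| homogeneous: "i < length xs \<Longrightarrow>
    Poly_Mapping.single (xs[i := c *\<^sub>C x]) 1 - c *\<^sub>C Poly_Mapping.single (xs[i := x]) 1
      \<in> null_chains"
| degenerate: "\<lbrakk>0 < i; i < length xs\<rbrakk> \<Longrightarrow> Poly_Mapping.single (xs[i := 1]) 1 \<in> null_chains"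

lemma null_chains_add: "p \<in> null_chains \<Longrightarrow> r \<in> null_chains \<Longrightarrow> p + r \<in> null_chains"
  using null_chains.lincomb[of p r 1] by simp

lemma null_chains_scaleC: "p \<in> null_chains \<Longrightarrow> c *\<^sub>C p \<in> null_chains"
  using null_chains.lincomb[of p 0 c] null_chains.zero by simp

lemma null_chains_minus: "p \<in> null_chains \<Longrightarrow> - p \<in> null_chains"
  using null_chains_scaleC[of p "- 1"] by simp

lemma null_chains_diff: "p \<in> null_chains \<Longrightarrow> r \<in> null_chains \<Longrightarrow> p - r \<in> null_chains"
  using null_chains_add[of p "- r"] null_chains_minus[of r] by simp

quotient_type (overloaded) 'a red_chain =
  "'a::cstar_algebra list \<Rightarrow>\<^sub>0 complex" / "\<lambda>p r. p - r \<in> null_chains"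
proof (rule equivpI)
  show "reflp (\<lambda>p r. p - r \<in> (null_chains :: ('a list \<Rightarrow>\<^sub>0 complex) set))"
    by (simp add: reflp_def null_chains.zero)
  show "symp (\<lambda>p r. p - r \<in> (null_chains :: ('a list \<Rightarrow>\<^sub>0 complex) set))"
    by (metis (no_types, lifting) minus_diff_eq null_chains_minus sympI)
  show "transp (\<lambda>p r. p - r \<in> (null_chains :: ('a list \<Rightarrow>\<^sub>0 complex) set))"
  proof (rule transpI)
    fix p r s :: "'a list \<Rightarrow>\<^sub>0 complex"
    assume "p - r \<in> null_chains" "r - s \<in> null_chains"
    then have "(p - r) + (r - s) \<in> null_chains" by (rule null_chains_add)
    then show "p - s \<in> null_chains" by simp
  qed
qed

instantiation red_chain :: (cstar_algebra) complex_vector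
begin

lift_definition zero_red_chain :: "'a red_chain" is 0 .

lift_definition plus_red_chain :: "'a red_chain \<Rightarrow> 'a red_chain \<Rightarrow> 'a red_chain" is "(+)"
  using null_chains_add by (metis (no_types, lifting) add_diff_add)

lift_definition uminus_red_chain :: "'a red_chain \<Rightarrow> 'a red_chain" is uminus
  using null_chains_minus by (metis (no_types, lifting) minus_diff_eq minus_diff_minus)

lift_definition minus_red_chain :: "'a red_chain \<Rightarrow> 'a red_chain \<Rightarrow> 'a red_chain" is "(-)"
proof -
  fix p p' r r' :: "'a list \<Rightarrow>\<^sub>0 complex"
  assume "p - p' \<in> null_chains" "r - r' \<in> null_chains"
  then have "(p - p') - (r - r') \<in> null_chains" by (rule null_chains_diff)
  then show "p - r - (p' - r') \<in> null_chains" by (simp add: algebra_simps)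
qed

lift_definition scaleC_red_chain :: "complex \<Rightarrow> 'a red_chain \<Rightarrow> 'a red_chain" is scaleC
  using null_chains_scaleC by (metis (no_types, lifting) scaleC_diff_right)

instance
  by standard (transfer; simp add: null_chains.zero algebra_simps
      scaleC_add_right scaleC_add_left)+

end

text \<open>The elementary tensor of the entries of a list.\<close>

lift_definition tensor :: "'a::cstar_algebra list \<Rightarrow> 'a red_chain"
  is "\<lambda>xs. Poly_Mapping.single xs 1" .

inductive_set red_chains :: "nat \<Rightarrow> 'a::cstar_algebra red_chain set" for m where
  "0 \<in> red_chains m"
| "\<lbrakk>x \<in> red_chains m; length as = m + 1\<rbrakk> \<Longrightarrow> x + c *\<^sub>C tensor as \<in> red_chains m"

text \<open>The linear map on reduced chains with prescribed values on elementary tensors; by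
  \<open>extend_tensor\<close> below it has these values if they are multilinear and vanish on degenerate
  lists.\<close>

definition lin_ext :: "('a list \<Rightarrow> 'v) \<Rightarrow> ('a list \<Rightarrow>\<^sub>0 complex) \<Rightarrow> 'v::complex_vector" where
  "lin_ext f p = (\<Sum>as\<in>Poly_Mapping.keys p. Poly_Mapping.lookup p as *\<^sub>C f as)"

definition extend :: "('a::cstar_algebra list \<Rightarrow> 'v) \<Rightarrow> 'a red_chain \<Rightarrow> 'v::complex_vector" where
  "extend f x = lin_ext f (rep_red_chain x)"

definition reduced_multilinear :: "('a::cstar_algebra list \<Rightarrow> 'v::complex_vector) \<Rightarrow> bool" where
  "reduced_multilinear f \<longleftrightarrow>
     (\<forall>i as x y. i < length as \<longrightarrow> f (as[i := x + y]) = f (as[i := x]) + f (as[i := y])) \<and>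
     (\<forall>i as c x. i < length as \<longrightarrow> f (as[i := c *\<^sub>C x]) = c *\<^sub>C f (as[i := x])) \<and>
     (\<forall>i as. 0 < i \<and> i < length as \<longrightarrow> f (as[i := 1]) = 0)"

lemma lin_ext_superset:
  assumes "finite S" "Poly_Mapping.keys p \<subseteq> S"
  shows "lin_ext f p = (\<Sum>as\<in>S. Poly_Mapping.lookup p as *\<^sub>C f as)"
  unfolding lin_ext_def
  by (rule sum.mono_neutral_left) (use assms in \<open>auto simp: in_keys_iff\<close>)

lemma lin_ext_add: "lin_ext f (p + r) = lin_ext f p + lin_ext f r"
proof -
  let ?S = "Poly_Mapping.keys p \<union> Poly_Mapping.keys r"
  have "Poly_Mapping.keys (p + r) \<subseteq> ?S" by (rule Poly_Mapping.keys_add)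
  then show ?thesis
    by (simp add: lin_ext_superset[of ?S] lookup_add scaleC_add_left sum.distrib)
qed

lemma lin_ext_scaleC: "lin_ext f (c *\<^sub>C p) = c *\<^sub>C lin_ext f p"
proof -
  have "Poly_Mapping.keys (c *\<^sub>C p) \<subseteq> Poly_Mapping.keys p"
    by (auto simp: in_keys_iff)
  then show ?thesis
    by (simp add: lin_ext_superset[of "Poly_Mapping.keys p"] scaleC_sum_right scaleC_complex_def)
qed

lemma lin_ext_diff: "lin_ext f (p - r) = lin_ext f p - lin_ext f r"
  using lin_ext_add[of f "p - r" r] by simp

lemma lin_ext_zero [simp]: "lin_ext f 0 = 0"
  by (simp add: lin_ext_def)

lemma lin_ext_single [simp]: "lin_ext f (Poly_Mapping.single as 1) = f as"
  by (simp add: lin_ext_def)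

lemma lin_ext_null:
  assumes "reduced_multilinear f" "p \<in> null_chains"
  shows "lin_ext f p = 0"
  using assms(2,1)
  by induction (simp_all add: lin_ext_add lin_ext_diff lin_ext_scaleC reduced_multilinear_def)

lemma extend_abs:
  assumes "reduced_multilinear f"
  shows "extend f (abs_red_chain p) = lin_ext f p"
proof -
  have "rep_red_chain (abs_red_chain p) - p \<in> null_chains"
    by (rule Quotient3_rep_abs[OF Quotient3_red_chain]) (simp add: null_chains.zero)
  from lin_ext_null[OF assms this] show ?thesis by (simp add: extend_def lin_ext_diff)
qed

lemma extend_tensor: "reduced_multilinear f \<Longrightarrow> extend f (tensor as) = f as"
  by (simp add: tensor.abs_eq extend_abs)

lemma red_chain_eq_abs: "x = abs_red_chain (rep_red_chain x)"
  by (rule Quotient3_abs_rep[OF Quotient3_red_chain, symmetric])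

lemma extend_add:
  assumes "reduced_multilinear f"
  shows "extend f (x + y) = extend f x + extend f y"
proof -
  have "extend f (abs_red_chain p + abs_red_chain r) =
      extend f (abs_red_chain p) + extend f (abs_red_chain r)" for p r
    by (simp add: plus_red_chain.abs_eq extend_abs[OF assms] lin_ext_add)
  from this[of "rep_red_chain x" "rep_red_chain y"] show ?thesis
    by (simp add: red_chain_eq_abs[symmetric])
qed

lemma extend_scaleC:
  assumes "reduced_multilinear f"
  shows "extend f (c *\<^sub>C x) = c *\<^sub>C extend f x"
proof -
  have "extend f (c *\<^sub>C abs_red_chain p) = c *\<^sub>C extend f (abs_red_chain p)" for p
    by (simp add: scaleC_red_chain.abs_eq extend_abs[OF assms] lin_ext_scaleC)
  from this[of "rep_red_chain x"] show ?thesis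
    by (simp add: red_chain_eq_abs[symmetric])
qed

section \<open>The operators of the bicomplex\<close>

text \<open>The operators are given by their values on \<open>a\<^sub>0 \<otimes> \<dots> \<otimes> a\<^sub>m\<close> with representatives \<open>a\<^sub>i\<close> in the
  algebra, \<open>m = length as - 1\<close>; a single term is not well defined on reduced chains, but the sum is
  (\<open>hochschild_tensor_multilinear\<close> and \<open>connes_tensor_multilinear\<close>). The map \<open>b\<close> is zero in degree 0.\<close>

definition face :: "nat \<Rightarrow> 'a::times list \<Rightarrow> 'a list" where
  "face j as = take j as @ [as ! j * as ! (j + 1)] @ drop (j + 2) as"

definition last_face :: "'a::times list \<Rightarrow> 'a list" where
  "last_face as = (last as * hd as) # butlast (tl as)"

definition hochschild_tensor :: "'a::cstar_algebra list \<Rightarrow> 'a red_chain" where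
  "hochschild_tensor as =
     (let m = length as - 1
      in if m = 0 then 0
         else (\<Sum>j<m. (-1) ^ j *\<^sub>C tensor (face j as)) + (-1) ^ m *\<^sub>C tensor (last_face as))"

definition hochschild_b :: "'a::cstar_algebra red_chain \<Rightarrow> 'a red_chain" where
  "hochschild_b = extend hochschild_tensor"

definition connes_B0 :: "'a::one list \<Rightarrow> 'a list" where
  "connes_B0 as = 1 # as"

text \<open>The prefactor of the cyclic antisymmetrization \<open>A\<close> in \<open>B = A B\<^sub>0\<close> is \<open>1/m\<close>, where \<open>m\<close> is the
  degree of the chain to which \<open>B\<close> is applied; the argument of \<open>A\<close> then has degree \<open>m + 1\<close>, which
  governs the sum and the signs. With \<open>m\<close> the degree of the argument of \<open>A\<close> instead, the prefactor
  on \<open>ch\<^sub>1\<close> would be \<open>1/3\<close> and \<open>B ch\<^sub>1\<close> could not equal \<open>b ch\<^sub>2\<close>. Degree \<open>m = 0\<close>, where \<open>1/m\<close> is meaningless, has prefactor 1.\<close>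

definition cyclic_A :: "nat \<Rightarrow> 'a::cstar_algebra list \<Rightarrow> 'a red_chain" where
  "cyclic_A m as =
     (1 / of_nat (max 1 m)) *\<^sub>C
       (\<Sum>j<length as. (-1) ^ ((length as - 1) * j) *\<^sub>C tensor (rotate j as))"

definition connes_tensor :: "'a::cstar_algebra list \<Rightarrow> 'a red_chain" where
  "connes_tensor as = cyclic_A (length as - 1) (connes_B0 as)"

definition connes_B :: "'a::cstar_algebra red_chain \<Rightarrow> 'a red_chain" where
  "connes_B = extend connes_tensor"

lemma tensor_multilinear: "reduced_multilinear tensor"
  unfolding reduced_multilinear_def
proof (intro conjI allI impI)
  show "tensor (as[i := x + y]) = tensor (as[i := x]) + tensor (as[i := y])"
    if "i < length as" for i and as :: "'a list" and x y
    using null_chains.additive[OF that, of x y]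
    by (simp add: tensor.abs_eq plus_red_chain.abs_eq red_chain.abs_eq_iff diff_diff_eq)
  show "tensor (as[i := c *\<^sub>C x]) = c *\<^sub>C tensor (as[i := x])"
    if "i < length as" for i and as :: "'a list" and c x
    using null_chains.homogeneous[OF that, of c x]
    by (simp add: tensor.abs_eq scaleC_red_chain.abs_eq red_chain.abs_eq_iff)
  show "tensor (as[i := 1]) = 0"
    if "0 < i \<and> i < length as" for i and as :: "'a list"
    using null_chains.degenerate[of i as] that
    by (simp add: tensor.abs_eq zero_red_chain.abs_eq red_chain.abs_eq_iff)
qed

lemma tensor_add: "i < length as \<Longrightarrow> tensor (as[i := x + y]) = tensor (as[i := x]) + tensor (as[i := y])"
  by (simp add: tensor_multilinear[unfolded reduced_multilinear_def])

lemma tensor_scaleC: "i < length as \<Longrightarrow> tensor (as[i := c *\<^sub>C x]) = c *\<^sub>C tensor (as[i := x])"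
  by (simp add: tensor_multilinear[unfolded reduced_multilinear_def])

lemma tensor_one: "0 < i \<Longrightarrow> i < length as \<Longrightarrow> as ! i = 1 \<Longrightarrow> tensor as = 0"
  using tensor_multilinear[unfolded reduced_multilinear_def, THEN conjunct2, THEN conjunct2,
      rule_format, of i as] list_update_id[of as i]
  by simp

definition slot_linear ::
    "('a::cstar_algebra list \<Rightarrow> 'v::complex_vector) \<Rightarrow> 'a list \<Rightarrow> nat \<Rightarrow> bool" where
  "slot_linear f as i \<longleftrightarrow>
     (\<forall>x y. f (as[i := x + y]) = f (as[i := x]) + f (as[i := y])) \<and>
     (\<forall>c x. f (as[i := c *\<^sub>C x]) = c *\<^sub>C f (as[i := x]))"

lemma slot_linearI:
  assumes "k < length bs" "\<And>x. F (as[i := x]) = bs[k := g x]"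
    and "\<And>x y. g (x + y) = g x + g y" "\<And>c x. g (c *\<^sub>C x) = c *\<^sub>C g x"
  shows "slot_linear (\<lambda>as. tensor (F as)) as i"
  using assms by (simp add: slot_linear_def tensor_add tensor_scaleC)

lemma slot_linear_add:
  "slot_linear f as i \<Longrightarrow> slot_linear g as i \<Longrightarrow> slot_linear (\<lambda>as. f as + g as) as i"
  by (simp add: slot_linear_def scaleC_add_right)

lemma slot_linear_scaleC: "slot_linear f as i \<Longrightarrow> slot_linear (\<lambda>as. c *\<^sub>C f as) as i"
  by (simp add: slot_linear_def scaleC_add_right mult.commute)

lemma slot_linear_sum:
  "(\<And>j. j \<in> J \<Longrightarrow> slot_linear (f j) as i) \<Longrightarrow> slot_linear (\<lambda>as. \<Sum>j\<in>J. f j as) as i"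
  by (simp add: slot_linear_def scaleC_sum_right sum.distrib)

lemma length_face: "j + 1 < length as \<Longrightarrow> length (face j as) = length as - 1"
  by (simp add: face_def)

lemma nth_face:
  assumes "j + 1 < length as" "k < length as - 1"
  shows "face j as ! k =
    (if k < j then as ! k else if k = j then as ! j * as ! (j + 1) else as ! (k + 1))"
proof -
  consider "k < j" | "k = j" | d where "k = Suc (j + d)"
    by (metis less_imp_Suc_add linorder_neqE_nat)
  then show ?thesis
    using assms by cases (auto simp: face_def nth_append)
qed

lemma length_last_face: "2 \<le> length as \<Longrightarrow> length (last_face as) = length as - 1"
  by (simp add: last_face_def)

lemma nth_last_face:
  assumes "2 \<le> length as" "k < length as - 1"
  shows "last_face as ! k = (if k = 0 then as ! (length as - 1) * as ! 0 else as ! k)"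
proof -
  have "as \<noteq> []" using assms by auto
  then show ?thesis
    using assms by (cases k) (auto simp: last_face_def last_conv_nth hd_conv_nth nth_butlast nth_tl)
qed

lemma face_slot_linear:
  assumes "i < length as" "j + 1 < length as"
  shows "slot_linear (\<lambda>as. tensor (face j as)) as i"
proof -
  consider "i < j" | "i = j" | "i = j + 1" | "i > j + 1" by linarith
  then show ?thesis
  proof cases
    case 1
    show ?thesis
      by (rule slot_linearI[of i "face j as" "face j" as i "\<lambda>x. x"])
        (use assms 1 in \<open>auto intro!: nth_equalityI simp: length_face nth_face nth_list_update\<close>)
  next
    case 2
    show ?thesis
      by (rule slot_linearI[of j "face j as" "face j" as i "\<lambda>x. x * as ! (j + 1)"])
        (use assms 2 in \<open>auto intro!: nth_equalityI simp: length_face nth_face nth_list_update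
           algebra_simps scaleC_mult_left\<close>)
  next
    case 3
    show ?thesis
      by (rule slot_linearI[of j "face j as" "face j" as i "\<lambda>x. as ! j * x"])
        (use assms 3 in \<open>auto intro!: nth_equalityI simp: length_face nth_face nth_list_update
           algebra_simps scaleC_mult_right\<close>)
  next
    case 4
    show ?thesis
      by (rule slot_linearI[of "i - 1" "face j as" "face j" as i "\<lambda>x. x"])
        (use assms 4 in \<open>auto intro!: nth_equalityI simp: length_face nth_face nth_list_update\<close>)
  qed
qed

lemma last_face_slot_linear:
  assumes "i < length as" "2 \<le> length as"
  shows "slot_linear (\<lambda>as. tensor (last_face as)) as i"
proof -
  have upd: "as[0 := x] ! 0 = x" for x using assms by (cases as) auto
  consider "i = 0" | "i = length as - 1" "i > 0" | "0 < i" "i < length as - 1"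
    using assms by linarith
  then show ?thesis
  proof cases
    case 1
    show ?thesis
      by (rule slot_linearI[of 0 "last_face as" last_face as i "\<lambda>x. as ! (length as - 1) * x"])
        (use assms 1 in \<open>auto intro!: nth_equalityI simp: length_last_face nth_last_face
           nth_list_update upd algebra_simps scaleC_mult_right\<close>)
  next
    case 2
    show ?thesis
      by (rule slot_linearI[of 0 "last_face as" last_face as i "\<lambda>x. x * as ! 0"])
        (use assms 2 in \<open>auto intro!: nth_equalityI simp: length_last_face nth_last_face
           nth_list_update algebra_simps scaleC_mult_left\<close>)
  next
    case 3
    show ?thesis
      by (rule slot_linearI[of i "last_face as" last_face as i "\<lambda>x. x"])
        (use assms 3 in \<open>auto intro!: nth_equalityI simp: length_last_face nth_last_face
           nth_list_update\<close>)
  qed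
qed

lemma hochschild_slot_linear:
  assumes "i < length as"
  shows "slot_linear hochschild_tensor as i"
proof (cases "length as < 2")
  case True
  then show ?thesis by (simp add: slot_linear_def hochschild_tensor_def)
next
  case False
  define m where "m = length as - 1"
  have "slot_linear (\<lambda>as. (\<Sum>j<m. (-1) ^ j *\<^sub>C tensor (face j as))
      + (-1) ^ m *\<^sub>C tensor (last_face as)) as i"
    by (intro slot_linear_add slot_linear_sum slot_linear_scaleC face_slot_linear
        last_face_slot_linear) (use assms False in \<open>auto simp: m_def\<close>)
  moreover have "hochschild_tensor (as[i := x]) =
      (\<Sum>j<m. (-1) ^ j *\<^sub>C tensor (face j (as[i := x])))
      + (-1) ^ m *\<^sub>C tensor (last_face (as[i := x]))" for x
    using False by (simp add: hochschild_tensor_def m_def Let_def)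
  ultimately show ?thesis by (simp add: slot_linear_def)
qed

lemma hochschild_degenerate:
  assumes "0 < i" "i < length as" "as ! i = 1"
  shows "hochschild_tensor as = 0"
proof -
  define m where "m = length as - 1"
  have len: "length as = Suc m" and m: "0 < m" "i \<le> m" using assms by (auto simp: m_def)
  have faces: "tensor (face j as) = 0" if "j < m" "j \<noteq> i" "j \<noteq> i - 1" for j
  proof (cases "j < i")
    case True
    show ?thesis
      by (rule tensor_one[of "i - 1"]) (use that True assms len m in \<open>auto simp: length_face nth_face\<close>)
  next
    case False
    show ?thesis
      by (rule tensor_one[of i]) (use that False assms len m in \<open>auto simp: length_face nth_face\<close>)
  qed
  have "(\<Sum>j<m. (-1) ^ j *\<^sub>C tensor (face j as)) + (-1) ^ m *\<^sub>C tensor (last_face as) = 0"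
  proof (cases "i = m")
    case True
    have "(\<Sum>j<m. (-1) ^ j *\<^sub>C tensor (face j as)) =
        (\<Sum>j\<in>{m - 1}. (-1) ^ j *\<^sub>C tensor (face j as))"
      by (rule sum.mono_neutral_right) (use faces True m in auto)
    moreover have "face (m - 1) as = last_face as"
      by (rule nth_equalityI; cases m)
        (use assms len m True in \<open>auto simp: length_face length_last_face nth_face nth_last_face
          less_Suc_eq\<close>)
    moreover have "(-1 :: complex) ^ m = - ((-1) ^ (m - 1))"
      using m by (cases m) auto
    ultimately show ?thesis by simp
  next
    case False
    have "tensor (last_face as) = 0"
      by (rule tensor_one[of i])
        (use assms len m False in \<open>auto simp: length_last_face nth_last_face\<close>)
    moreover have "(\<Sum>j<m. (-1) ^ j *\<^sub>C tensor (face j as)) =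
        (\<Sum>j\<in>{i - 1, i}. (-1) ^ j *\<^sub>C tensor (face j as))"
      by (rule sum.mono_neutral_right) (use faces False m assms in auto)
    moreover have "face (i - 1) as = face i as"
    proof (rule nth_equalityI)
      fix k assume "k < length (face (i - 1) as)"
      then show "face (i - 1) as ! k = face i as ! k"
        using assms len m False by (cases "k < i - 1"; cases "k = i - 1"; cases "k = i")
          (auto simp: length_face nth_face)
    qed (use assms len m False in \<open>auto simp: length_face\<close>)
    moreover have "(-1 :: complex) ^ i = - ((-1) ^ (i - 1))"
      using assms by (cases i) auto
    ultimately show ?thesis using assms by simp
  qed
  then show ?thesis using m by (simp add: hochschild_tensor_def m_def Let_def)
qed

lemma hochschild_tensor_multilinear: "reduced_multilinear hochschild_tensor"
  using hochschild_slot_linear hochschild_degenerate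
  unfolding reduced_multilinear_def slot_linear_def by (metis length_list_update nth_list_update_eq)

lemma rotate_slot_linear:
  assumes "i < length as"
  shows "slot_linear (\<lambda>as. tensor (rotate j (1 # as))) as i"
proof -
  obtain n r where n: "n = length as + 1" and r: "r = j mod n" by simp
  have "r < n" using n r by simp
  have mod_once: "x mod n = (if x < n then x else x - n)" if "x < 2 * n" for x
    using that by (simp add: le_mod_geq)
  define k where "k = (if r \<le> Suc i then Suc i - r else Suc i + n - r)"
  have "k < n" using assms \<open>r < n\<close> n by (auto simp: k_def)
  have k: "(j + l) mod n = Suc i \<longleftrightarrow> l = k" if "l < n" for l
  proof -
    have "(j + l) mod n = (r + l) mod n" by (simp add: r mod_simps)
    also have "\<dots> = (if r + l < n then r + l else r + l - n)"
      using that \<open>r < n\<close> by (intro mod_once) linarith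
    finally show ?thesis
      using that assms \<open>r < n\<close> n by (auto simp: k_def split: if_splits)
  qed
  have "rotate j (1 # as[i := x]) = (rotate j (1 # as))[k := x]" for x
  proof (rule nth_equalityI)
    fix l assume "l < length (rotate j (1 # as[i := x]))"
    then have l: "l < n" by (simp add: n)
    have "rotate j (1 # as[i := x]) ! l = ((1 # as)[Suc i := x]) ! ((j + l) mod n)"
      using l by (simp add: nth_rotate n)
    also have "\<dots> = (if (j + l) mod n = Suc i then x else (1 # as) ! ((j + l) mod n))"
      using assms by (subst nth_list_update) auto
    also have "\<dots> = (rotate j (1 # as))[k := x] ! l"
      using l k[OF l] \<open>k < n\<close> by (auto simp: nth_list_update nth_rotate n)
    finally show "rotate j (1 # as[i := x]) ! l = (rotate j (1 # as))[k := x] ! l" .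
  qed simp
  then show ?thesis
    by (intro slot_linearI[of k "rotate j (1 # as)" "\<lambda>as. rotate j (1 # as)" as i "\<lambda>x. x"])
      (use \<open>k < n\<close> in \<open>auto simp: n\<close>)
qed

lemma connes_tensor_multilinear: "reduced_multilinear connes_tensor"
proof -
  have lin: "slot_linear connes_tensor as i" if "i < length as" for i and as :: "'a list"
  proof -
    define n where "n = length as"
    define c :: complex where "c = 1 / of_nat (max 1 (n - 1))"
    have "slot_linear (\<lambda>as. c *\<^sub>C
        (\<Sum>j<n + 1. (-1) ^ (n * j) *\<^sub>C tensor (rotate j (1 # as)))) as i"
      by (intro slot_linear_scaleC slot_linear_sum rotate_slot_linear that)
    moreover have "connes_tensor (as[i := x]) =
        c *\<^sub>C (\<Sum>j<n + 1. (-1) ^ (n * j) *\<^sub>C tensor (rotate j (1 # as[i := x])))" for x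
      by (simp add: connes_tensor_def cyclic_A_def connes_B0_def c_def n_def)
    ultimately show ?thesis by (simp add: slot_linear_def)
  qed
  have "tensor (rotate j (1 # as)) = 0"
    if "0 < i" "i < length as" "as ! i = 1" for i j and as :: "'a list"
  proof -
    obtain n r where n: "n = length as + 1" and r: "r = j mod n" by simp
    have "r < n" using n r by simp
    let ?r = "rotate j (1 # as)"
    have pos: "\<exists>l<n. ?r ! l = (1 # as) ! p \<and> (j + l) mod n = p" if "p < n" for p
    proof -
      define l where "l = (p + (n - r)) mod n"
      have "(j + l) mod n = (r + (p + (n - r))) mod n"
        by (simp add: r l_def mod_simps)
      also have "r + (p + (n - r)) = p + n"
        using \<open>r < n\<close> by simp
      finally have "(j + l) mod n = p" using that by simp
      moreover have "l < n" using that by (simp add: l_def)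
      ultimately show ?thesis by (intro exI[of _ l]) (simp add: nth_rotate n)
    qed
    have "0 < n" "Suc i < n" using that n by auto
    obtain l where l: "l < n" "?r ! l = (1 # as) ! 0" "(j + l) mod n = 0"
      using pos[OF \<open>0 < n\<close>] by (elim exE conjE)
    obtain l' where l': "l' < n" "?r ! l' = (1 # as) ! Suc i" "(j + l') mod n = Suc i"
      using pos[OF \<open>Suc i < n\<close>] by (elim exE conjE)
    have "0 < l \<or> 0 < l'" using l l' by (cases "l = 0"; cases "l' = 0") auto
    then show ?thesis
      using l l' that tensor_one[of l ?r] tensor_one[of l' ?r] by (auto simp: n)
  qed
  then have "connes_tensor as = 0"
    if "0 < i" "i < length as" "as ! i = 1" for i and as :: "'a list"
    using that by (simp add: connes_tensor_def cyclic_A_def connes_B0_def)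
  then show ?thesis
    using lin unfolding reduced_multilinear_def slot_linear_def
    by (metis length_list_update nth_list_update_eq)
qed

text \<open>A chain of total degree \<open>2N\<close> in the bicomplex has components \<open>c n\<close> of degree \<open>2n\<close>, \<open>n \<le> N\<close>. It
  is a cycle if \<open>b\<close> of each component cancels \<open>B\<close> of the previous one. The convention is that of the
  total differential \<open>b - B\<close>; replacing \<open>c n\<close> by \<open>(-1)\<^sup>n c n\<close> turns it into \<open>b + B\<close>.\<close>

definition bB_cycle :: "nat \<Rightarrow> (nat \<Rightarrow> 'a::cstar_algebra red_chain) \<Rightarrow> bool" where
  "bB_cycle N c \<longleftrightarrow>
     (\<forall>n\<le>N. c n \<in> red_chains (2 * n)) \<and> hochschild_b (c 0) = 0 \<and>
     (\<forall>n<N. hochschild_b (c (n + 1)) = connes_B (c n))"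

section \<open>The projection and its character\<close>

text \<open>The summand of a list \<open>I\<close> of indices has the entry of the \<open>k\<close>-th matrix at row \<open>I ! k\<close> and
  column \<open>I ! (k + 1)\<close>, cyclically, as its \<open>k\<close>-th tensor factor.\<close>

definition matrix_tensor_trace :: "('a::cstar_algebra^4^4) list \<Rightarrow> 'a red_chain" where
  "matrix_tensor_trace Ms =
     (\<Sum>I | length I = length Ms.
        tensor (map (\<lambda>k. Ms ! k $ (I ! k) $ (I ! ((k + 1) mod length Ms))) [0..<length Ms]))"

definition chern_connes :: "'a::cstar_algebra^4^4 \<Rightarrow> nat \<Rightarrow> 'a red_chain" where
  "chern_connes e n =
     matrix_tensor_trace ((e - (1/2) *\<^sub>R mat 1) # replicate (2 * n) e)"

definition sphere_projection :: "real \<Rightarrow> 'a::cstar_algebra \<Rightarrow> 'a \<Rightarrow> 'a \<Rightarrow> 'a^4^4" where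
  "sphere_projection q \<alpha> \<beta> z = (1/2) *\<^sub>R vector
     [vector [1 + z,    0,          \<alpha>,               \<beta>],
      vector [0,        1 + z,      - q *\<^sub>R star \<beta>,   star \<alpha>],
      vector [star \<alpha>,   - q *\<^sub>R \<beta>,  1 - z,           0],
      vector [star \<beta>,   \<alpha>,          0,               1 - z]]"

end

theory Submission
  imports Defs
begin

text \<open>Write \<open>T(M\<^sub>0, \<dots>, M\<^sub>m)\<close> for the trace \<open>matrix_tensor_trace\<close>. Contracting the index shared by two
  neighbouring matrices turns the product of two tensor factors into an entry of the matrix product.
  So \<open>b\<close> acts on \<open>T(M\<^sub>0, \<dots>, M\<^sub>m)\<close> by the Hochschild formula for matrices (\<open>hochschild_b_trace\<close>).
  Moreover \<open>T\<close> is multilinear and vanishes if a matrix other than the first is \<open>1\<close>.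

  Let \<open>e\<close> be idempotent. In \<open>b T(e - 1/2, e, \<dots>, e)\<close> with \<open>2n\<close> entries \<open>e\<close> after the first, the two faces
  involving \<open>e - 1/2\<close> give \<open>T(e/2, e, \<dots>, e)\<close> each, and the \<open>2n - 1\<close> inner faces, with alternating signs,
  leave one copy of \<open>- T(e - 1/2, e, \<dots>, e)\<close>. The sum is \<open>b ch\<^sub>n = 1/2 T(1, e, \<dots>, e)\<close> with \<open>2n - 1\<close>
  entries \<open>e\<close> (\<open>hochschild_b_chern_connes\<close>). On the other hand, only the unrotated term of the cyclic
  sum in \<open>B\<close> has no \<open>1\<close> in a reduced slot, and \<open>e - 1/2\<close> may be replaced by \<open>e\<close> there, so
  \<open>B ch\<^sub>n = 1/(2n) T(1, e, \<dots>, e)\<close> with \<open>2n + 1\<close> entries \<open>e\<close>, if \<open>n > 0\<close> (\<open>connes_B_chern_connes\<close>). For \<open>n = 1\<close> the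
  factor \<open>1/(2n)\<close> is \<open>1/2\<close>, hence \<open>B ch\<^sub>1 = b ch\<^sub>2\<close> for every idempotent.

  What is particular to the sphere is that \<open>e = (1 + v)/2\<close> with \<open>v\<^sup>2 = 1\<close>, which is where the defining
  relations enter (\<open>sphere_involution_square\<close>), and the values of two traces. As \<open>1\<close> vanishes in the
  reduced slots, \<open>T(1, e) = 1/2 T(1, v)\<close> and \<open>T(1, e, e, e) = 1/8 T(1, v, v, v)\<close>. The first, like
  \<open>ch\<^sub>0 = 1/2 T(v)\<close>, is zero since \<open>v\<close> has trace zero. The second is a sum over closed walks of length three on the index set; the
  contributions of \<open>\<alpha>\<close> cancel, and those of \<open>\<beta>\<close> cancel up to the factor \<open>1 - q\<^sup>2\<close>
  (\<open>reduced_trace_projection_3\<close>).\<close>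

section \<open>Index lists\<close>

text \<open>The summation over the index at position \<open>p\<close> is made innermost, so that this index can be
  contracted.\<close>

lemma sum_lists_insert:
  fixes g :: "'i::finite list \<Rightarrow> 'v::comm_monoid_add"
  assumes "p \<le> n"
  shows "(\<Sum>I | length I = Suc n. g I) =
    (\<Sum>J | length J = n. \<Sum>l\<in>UNIV. g (take p J @ l # drop p J))"
proof -
  have "(\<Sum>I | length I = Suc n. g I) =
      (\<Sum>(J, l)\<in>{J. length J = n} \<times> UNIV. g (take p J @ l # drop p J))"
  proof (rule sum.reindex_bij_witness[where
        j = "\<lambda>I. (take p I @ drop (Suc p) I, I ! p)" and
        i = "\<lambda>(J, l). take p J @ l # drop p J"], goal_cases)
    case (1 I)
    then have "p < length I" using assms by simp
    then show ?case by (simp add: id_take_nth_drop[symmetric])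
  qed (use assms in \<open>auto simp: nth_append id_take_nth_drop[symmetric]\<close>)
  then show ?thesis by (simp add: sum.cartesian_product)
qed

lemma sum_lists_Cons:
  fixes g :: "'i::finite list \<Rightarrow> 'v::comm_monoid_add"
  shows "(\<Sum>I | length I = Suc n. g I) = (\<Sum>J | length J = n. \<Sum>l\<in>UNIV. g (l # J))"
  using sum_lists_insert[of 0 n g] by simp

section \<open>Operators on elementary tensors and sums\<close>

lemma extend_zero: "reduced_multilinear f \<Longrightarrow> extend f 0 = 0"
  using extend_add[of f 0 0] by simp

lemma extend_sum:
  assumes "reduced_multilinear f"
  shows "extend f (\<Sum>i\<in>S. g i) = (\<Sum>i\<in>S. extend f (g i))"
  by (induction S rule: infinite_finite_induct)
    (simp_all add: extend_add[OF assms] extend_zero[OF assms])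

lemma tensor_one_after_rotate:
  assumes "0 < j" "j \<le> length as"
  shows "tensor (rotate j (1 # as)) = 0"
  by (rule tensor_one[of "Suc (length as) - j"]) (use assms in \<open>auto simp: nth_rotate\<close>)

text \<open>Every nontrivial rotation moves the leading \<open>1\<close> into a reduced slot.\<close>

lemma connes_tensor_eq:
  assumes "as \<noteq> []"
  shows "connes_tensor as = (1 / of_nat (max 1 (length as - 1))) *\<^sub>C tensor (1 # as)"
proof -
  have "(\<Sum>j<Suc (length as). (-1) ^ (length as * j) *\<^sub>C tensor (rotate j (1 # as))) =
      (\<Sum>j\<in>{0}. (-1) ^ (length as * j) *\<^sub>C tensor (rotate j (1 # as)))"
    by (rule sum.mono_neutral_right) (auto simp: tensor_one_after_rotate)
  then show ?thesis
    by (simp add: connes_tensor_def cyclic_A_def connes_B0_def)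
qed

lemma tensor_zero: "k < length as \<Longrightarrow> tensor (as[k := 0]) = 0"
  using tensor_scaleC[of k as 0 0] by simp

lemma tensor_sum:
  "k < length as \<Longrightarrow> tensor (as[k := \<Sum>l\<in>L. f l]) = (\<Sum>l\<in>L. tensor (as[k := f l]))"
  by (induction L rule: infinite_finite_induct) (simp_all add: tensor_zero tensor_add)

section \<open>The trace and the bicomplex operators\<close>

text \<open>The tensor factors of one summand of \<open>matrix_tensor_trace\<close>, as a function to which faces and
  rotations can be applied.\<close>

definition cyclic_entries :: "('a::zero^'n^'n) list \<Rightarrow> 'n list \<Rightarrow> 'a list" where
  "cyclic_entries Ms I =
     map (\<lambda>k. Ms ! k $ (I ! k) $ (I ! ((k + 1) mod length Ms))) [0..<length Ms]"

lemma length_cyclic_entries [simp]: "length (cyclic_entries Ms I) = length Ms"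
  by (simp add: cyclic_entries_def)

lemma nth_cyclic_entries:
  "k < length Ms \<Longrightarrow> cyclic_entries Ms I ! k = Ms ! k $ (I ! k) $ (I ! ((k + 1) mod length Ms))"
  by (simp add: cyclic_entries_def)

lemma cyclic_entries_update:
  assumes "k < length Ms"
  shows "cyclic_entries (Ms[k := M]) I =
    (cyclic_entries Ms I)[k := M $ (I ! k) $ (I ! ((k + 1) mod length Ms))]"
  by (rule nth_equalityI) (use assms in \<open>auto simp: nth_cyclic_entries nth_list_update\<close>)

lemma matrix_tensor_trace_eq:
  "matrix_tensor_trace Ms = (\<Sum>I | length I = length Ms. tensor (cyclic_entries Ms I))"
  by (simp add: matrix_tensor_trace_def cyclic_entries_def)

text \<open>The analogue of \<open>face\<close> with the matrix product, which is not the multiplication \<open>*\<close> of the type of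
  matrices; that one is componentwise.\<close>

definition matrix_face :: "nat \<Rightarrow> ('a::semiring_1^'n^'n) list \<Rightarrow> ('a^'n^'n) list" where
  "matrix_face j Ms = take j Ms @ [Ms ! j ** Ms ! (j + 1)] @ drop (j + 2) Ms"

text \<open>The index \<open>l\<close> shared by the matrices \<open>j\<close> and \<open>j + 1\<close> occurs in the \<open>j\<close>-th factor of the face only.
  Summed over \<open>l\<close>, that factor is an entry of the matrix product.\<close>

lemma face_cyclic_entries:
  assumes "j + 1 < length Ms" "length J = length Ms - 1"
  shows "face j (cyclic_entries Ms (take (j + 1) J @ l # drop (j + 1) J)) =
    (cyclic_entries (matrix_face j Ms) J)
      [j := Ms ! j $ (J ! j) $ l * Ms ! (j + 1) $ l $ (J ! ((j + 1) mod (length Ms - 1)))]"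
proof (rule nth_equalityI)
  define m where "m = length Ms - 1"
  define I where "I = take (j + 1) J @ l # drop (j + 1) J"
  have len: "length Ms = Suc m" "j < m" "length J = m" using assms by (auto simp: m_def)
  have lf: "length (matrix_face j Ms) = m" using len by (simp add: matrix_face_def)
  have nf: "matrix_face j Ms ! k =
      (if k < j then Ms ! k else if k = j then Ms ! j ** Ms ! (j + 1) else Ms ! (k + 1))"
    if "k < m" for k
    using that len
    by (cases k j rule: linorder_cases) (auto simp: matrix_face_def nth_append nth_Cons' Suc_diff_Suc)
  have I: "I ! k = (if k \<le> j then J ! k else if k = Suc j then l else J ! (k - 1))" if "k \<le> m" for k
  proof -
    consider "k < Suc j" | "k = Suc j" | d where "k = Suc (Suc (j + d))"
      by (metis add_Suc less_imp_Suc_add linorder_neqE_nat)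
    then show ?thesis using that len by cases (auto simp: I_def nth_append min_def)
  qed
  fix k assume "k < length (face j (cyclic_entries Ms (take (j + 1) J @ l # drop (j + 1) J)))"
  then have k: "k < m" using len by (simp add: length_face)
  let ?R = "(cyclic_entries (matrix_face j Ms) J)
    [j := Ms ! j $ (J ! j) $ l * Ms ! (j + 1) $ l $ (J ! ((j + 1) mod (length Ms - 1)))]"
  have "face j (cyclic_entries Ms I) ! k = ?R ! k"
  proof (cases "Suc k = m")
    \<comment> \<open>only the last entry closes the cycle, with column index \<open>J ! 0\<close>\<close>
    case True
    then show ?thesis
      using len(2)
      by (auto simp: nth_face nth_cyclic_entries lf nf I nth_list_update len True[symmetric])
  next
    case False
    then show ?thesis
      using k len by (auto simp: nth_face nth_cyclic_entries lf nf I nth_list_update)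
  qed
  then show "face j (cyclic_entries Ms (take (j + 1) J @ l # drop (j + 1) J)) ! k = ?R ! k"
    by (simp only: I_def)
qed (use assms in \<open>auto simp: length_face matrix_face_def\<close>)

lemma sum_face_cyclic_entries:
  fixes Ms :: "('a::cstar_algebra^4^4) list"
  assumes "j + 1 < length Ms"
  shows "(\<Sum>I | length I = length Ms. tensor (face j (cyclic_entries Ms I))) =
    matrix_tensor_trace (matrix_face j Ms)"
proof -
  define m where "m = length Ms - 1"
  have len: "length Ms = Suc m" "j < m" using assms by (auto simp: m_def)
  have lf: "length (matrix_face j Ms) = m" using len by (simp add: matrix_face_def)
  have "(\<Sum>l\<in>UNIV. tensor (face j (cyclic_entries Ms (take (j + 1) J @ l # drop (j + 1) J)))) =
      tensor (cyclic_entries (matrix_face j Ms) J)" if J: "length J = m" for J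
  proof -
    let ?c = "cyclic_entries (matrix_face j Ms) J"
    have "(\<Sum>l\<in>UNIV. tensor (face j (cyclic_entries Ms (take (j + 1) J @ l # drop (j + 1) J)))) =
        tensor (?c[j := \<Sum>l\<in>UNIV. Ms ! j $ (J ! j) $ l * Ms ! (j + 1) $ l $ (J ! ((j + 1) mod m))])"
    proof -
      have "face j (cyclic_entries Ms (take (j + 1) J @ l # drop (j + 1) J)) =
          ?c[j := Ms ! j $ (J ! j) $ l * Ms ! (j + 1) $ l $ (J ! ((j + 1) mod m))]" for l
        using face_cyclic_entries[of j Ms J l] len J by simp
      then show ?thesis using len by (simp only: tensor_sum length_cyclic_entries lf)
    qed
    also have "(\<Sum>l\<in>UNIV. Ms ! j $ (J ! j) $ l * Ms ! (j + 1) $ l $ (J ! ((j + 1) mod m))) = ?c ! j"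
      using len by (simp add: nth_cyclic_entries lf) (simp add: matrix_face_def nth_append matrix_matrix_mult_def)
    finally show ?thesis by simp
  qed
  then show ?thesis
    using len by (simp add: matrix_tensor_trace_eq lf sum_lists_insert[of "j + 1" m])
qed

lemma rotate1_cyclic_entries:
  assumes "length I = length Ms"
  shows "rotate1 (cyclic_entries Ms I) = cyclic_entries (rotate1 Ms) (rotate1 I)"
proof (rule nth_equalityI)
  fix k assume "k < length (rotate1 (cyclic_entries Ms I))"
  then have k: "k < length Ms" by simp
  then have "Suc k mod length Ms < length Ms" by (intro mod_less_divisor) linarith
  then show "rotate1 (cyclic_entries Ms I) ! k = cyclic_entries (rotate1 Ms) (rotate1 I) ! k"
    using k assms by (simp add: nth_rotate1 nth_cyclic_entries)
qed simp

lemma rotate_cyclic_entries: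
  "length I = length Ms \<Longrightarrow>
    rotate k (cyclic_entries Ms I) = cyclic_entries (rotate k Ms) (rotate k I)"
  by (induction k) (simp_all add: rotate1_cyclic_entries)

lemma sum_lists_rotate:
  fixes g :: "'i list \<Rightarrow> 'v::comm_monoid_add"
  assumes "k \<le> n"
  shows "(\<Sum>I | length I = n. g (rotate k I)) = (\<Sum>I | length I = n. g I)"
proof -
  have inv: "rotate (n - k) (rotate k I) = I" "rotate k (rotate (n - k) I) = I"
    if "length I = n" for I :: "'i list"
    using assms that by (simp_all add: rotate_rotate)
  show ?thesis
    by (rule sum.reindex_bij_witness[of _ "rotate (n - k)" "rotate k"]) (auto simp: inv)
qed

text \<open>A rotation brings the last entry in front of the first. The last face of a trace is thereby reduced
  to a face at position \<open>0\<close>, because the cyclic sum over indices is invariant under rotation.\<close>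

lemma last_face_eq_face_rotate:
  assumes "2 \<le> length as"
  shows "last_face as = face 0 (rotate (length as - 1) as)"
proof (rule nth_equalityI)
  fix k assume "k < length (last_face as)"
  then have "k + 1 < length as" using assms by (simp add: length_last_face)
  moreover have "(length as - 1 + k) mod length as = k - 1" if "0 < k"  "k < length as" for k
  proof -
    have "length as - 1 + k = length as + (k - 1)" using that by simp
    then show ?thesis using that by (simp only: mod_add_self1 mod_less)
  qed
  moreover have "as \<noteq> []" "Suc (length as - Suc 0) = length as" using assms by auto
  ultimately show "last_face as ! k = face 0 (rotate (length as - 1) as) ! k"
    using assms by (auto simp: nth_face nth_last_face nth_rotate)
qed (use assms in \<open>auto simp: length_face length_last_face\<close>)

lemma sum_last_face_cyclic_entries:
  fixes Ms :: "('a::cstar_algebra^4^4) list"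
  assumes "2 \<le> length Ms"
  shows "(\<Sum>I | length I = length Ms. tensor (last_face (cyclic_entries Ms I))) =
    matrix_tensor_trace (matrix_face 0 (rotate (length Ms - 1) Ms))"
proof -
  let ?r = "rotate (length Ms - 1)"
  have "(\<Sum>I | length I = length Ms. tensor (last_face (cyclic_entries Ms I))) =
      (\<Sum>I | length I = length Ms. tensor (face 0 (cyclic_entries (?r Ms) (?r I))))"
    by (rule sum.cong) (use assms in \<open>simp_all add: last_face_eq_face_rotate rotate_cyclic_entries\<close>)
  also have "\<dots> = (\<Sum>I | length I = length Ms. tensor (face 0 (cyclic_entries (?r Ms) I)))"
    by (rule sum_lists_rotate) simp
  also have "\<dots> = matrix_tensor_trace (matrix_face 0 (?r Ms))"
    using sum_face_cyclic_entries[of 0 "?r Ms"] assms by simp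
  finally show ?thesis .
qed

text \<open>The trace commutes with every face, so it carries the Hochschild boundary of a list of matrices
  to \<open>b\<close>.\<close>

lemma hochschild_b_trace:
  assumes "length Ms = Suc m" "0 < m"
  shows "hochschild_b (matrix_tensor_trace Ms) =
    (\<Sum>j<m. (-1) ^ j *\<^sub>C matrix_tensor_trace (matrix_face j Ms))
    + (-1) ^ m *\<^sub>C matrix_tensor_trace (matrix_face 0 (rotate m Ms))"
proof -
  have "hochschild_b (matrix_tensor_trace Ms) =
      (\<Sum>I | length I = length Ms. hochschild_tensor (cyclic_entries Ms I))"
    by (simp add: matrix_tensor_trace_eq hochschild_b_def extend_sum extend_tensor
        hochschild_tensor_multilinear)
  also have "\<dots> = (\<Sum>I | length I = length Ms.
      (\<Sum>j<m. (-1) ^ j *\<^sub>C tensor (face j (cyclic_entries Ms I)))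
      + (-1) ^ m *\<^sub>C tensor (last_face (cyclic_entries Ms I)))"
    using assms by (simp add: hochschild_tensor_def)
  also have "\<dots> = (\<Sum>j<m. (-1) ^ j *\<^sub>C
        (\<Sum>I | length I = length Ms. tensor (face j (cyclic_entries Ms I))))
      + (-1) ^ m *\<^sub>C (\<Sum>I | length I = length Ms. tensor (last_face (cyclic_entries Ms I)))"
    by (subst sum.distrib, subst sum.swap) (simp add: scaleC_sum_right)
  also have "\<dots> = (\<Sum>j<m. (-1) ^ j *\<^sub>C matrix_tensor_trace (matrix_face j Ms))
      + (-1) ^ m *\<^sub>C matrix_tensor_trace (matrix_face 0 (rotate m Ms))"
  proof -
    have "(\<Sum>I | length I = length Ms. tensor (face j (cyclic_entries Ms I))) =
        matrix_tensor_trace (matrix_face j Ms)" if "j < m" for j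
      using that assms by (intro sum_face_cyclic_entries) simp
    then show ?thesis
      using assms sum_last_face_cyclic_entries[of Ms] by simp
  qed
  finally show ?thesis .
qed

text \<open>The entries of \<open>mat 1\<close> are Kronecker deltas. They remove the extra index and leave a \<open>1\<close> in the first
  slot, which is what \<open>B\<^sub>0\<close> inserts.\<close>

lemma trace_mat_1_Cons:
  fixes Ms :: "('a::cstar_algebra^4^4) list"
  assumes "Ms \<noteq> []"
  shows "matrix_tensor_trace (mat 1 # Ms) =
    (\<Sum>I | length I = length Ms. tensor (1 # cyclic_entries Ms I))"
proof -
  obtain n where n: "length Ms = Suc n" using assms by (cases Ms) auto
  have "(\<Sum>l\<in>UNIV. tensor (cyclic_entries (mat 1 # Ms) (l # J))) = tensor (1 # cyclic_entries Ms J)"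
    if J: "length J = length Ms" for J
  proof -
    have off: "tensor (cyclic_entries (mat 1 # Ms) (l # J)) = 0" if "l \<noteq> J ! 0" for l
    proof -
      have "cyclic_entries (mat 1 # Ms) (l # J) = (cyclic_entries (mat 1 # Ms) (l # J))[0 := 0]"
        using that n by (intro nth_equalityI) (auto simp: nth_cyclic_entries nth_list_update mat_def)
      then show ?thesis by (metis tensor_zero length_cyclic_entries length_Cons zero_less_Suc)
    qed
    have "cyclic_entries (mat 1 # Ms) (J ! 0 # J) = 1 # cyclic_entries Ms J"
    proof (rule nth_equalityI)
      fix k assume k: "k < length (cyclic_entries (mat 1 # Ms) (J ! 0 # J))"
      show "cyclic_entries (mat 1 # Ms) (J ! 0 # J) ! k = (1 # cyclic_entries Ms J) ! k"
      proof (cases k)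
        case 0
        then show ?thesis using n by (simp add: nth_cyclic_entries mat_def)
      next
        case (Suc k')
        then show ?thesis using n k by (cases "k' = n") (auto simp: nth_cyclic_entries)
      qed
    qed simp
    moreover have "(\<Sum>l\<in>UNIV. tensor (cyclic_entries (mat 1 # Ms) (l # J))) =
        (\<Sum>l\<in>{J ! 0}. tensor (cyclic_entries (mat 1 # Ms) (l # J)))"
      by (rule sum.mono_neutral_right) (auto simp: off)
    ultimately show ?thesis by simp
  qed
  then show ?thesis
    by (simp add: matrix_tensor_trace_eq sum_lists_Cons)
qed

lemma connes_B_trace:
  fixes Ms :: "('a::cstar_algebra^4^4) list"
  assumes "length Ms = Suc m" "0 < m"
  shows "connes_B (matrix_tensor_trace Ms) = (1 / of_nat m) *\<^sub>C matrix_tensor_trace (mat 1 # Ms)"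
proof -
  have "Ms \<noteq> []" "\<And>I. cyclic_entries Ms I \<noteq> []"
    using assms by (metis length_0_conv nat.simps(3), metis length_0_conv length_cyclic_entries nat.simps(3))
  moreover have "connes_B (matrix_tensor_trace Ms) =
      (\<Sum>I | length I = length Ms. connes_tensor (cyclic_entries Ms I))"
    by (simp add: matrix_tensor_trace_eq connes_B_def extend_sum extend_tensor
        connes_tensor_multilinear)
  ultimately show ?thesis
    using assms by (simp add: trace_mat_1_Cons connes_tensor_eq scaleC_sum_right max_def)
qed

lemma trace_add:
  fixes Ms :: "('a::cstar_algebra^4^4) list"
  assumes "k < length Ms"
  shows "matrix_tensor_trace (Ms[k := M + N]) =
    matrix_tensor_trace (Ms[k := M]) + matrix_tensor_trace (Ms[k := N])"
  using assms
  by (simp add: matrix_tensor_trace_eq cyclic_entries_update tensor_add sum.distrib)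

lemma trace_scaleR:
  fixes Ms :: "('a::cstar_algebra^4^4) list"
  assumes "k < length Ms"
  shows "matrix_tensor_trace (Ms[k := r *\<^sub>R M]) =
    complex_of_real r *\<^sub>C matrix_tensor_trace (Ms[k := M])"
  using assms
  by (simp add: matrix_tensor_trace_eq cyclic_entries_update scaleR_scaleC tensor_scaleC
      scaleC_sum_right)

text \<open>The entries of \<open>mat 1\<close> are scalars, and these are zero in a reduced slot.\<close>

lemma trace_mat_1:
  fixes Ms :: "('a::cstar_algebra^4^4) list"
  assumes "0 < k" "k < length Ms"
  shows "matrix_tensor_trace (Ms[k := mat 1]) = 0"
proof -
  have "tensor (as[k := 1]) = 0" if "length as = length Ms" for as :: "'a list"
    using that assms by (intro tensor_one[of k]) auto
  then show ?thesis
    using assms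
    by (auto simp: matrix_tensor_trace_eq cyclic_entries_update mat_def tensor_zero intro!: sum.neutral)
qed

lemma trace_in_red_chains:
  assumes "length Ms = m + 1"
  shows "matrix_tensor_trace Ms \<in> red_chains m"
proof -
  have "(\<Sum>I\<in>S. tensor (cyclic_entries Ms I)) \<in> red_chains m" for S
  proof (induction S rule: infinite_finite_induct)
    case (insert I S)
    then show ?case
      using red_chains.intros(2)[OF insert.IH, of "cyclic_entries Ms I" 1] assms
      by (simp add: add.commute)
  qed (simp_all add: red_chains.intros(1))
  then show ?thesis by (simp add: matrix_tensor_trace_eq)
qed

section \<open>The character of an idempotent\<close>

lemma matrix_add_rdistrib: "(A + B) ** C = A ** C + B ** C"
  by (simp add: matrix_matrix_mult_def vec_eq_iff sum.distrib distrib_right)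

lemma idempotent_shift_mult:
  fixes e :: "'a::real_algebra_1^'n^'n"
  assumes "e ** e = e"
  shows "(e - (1/2) *\<^sub>R mat 1) ** e = (1/2) *\<^sub>R e" "e ** (e - (1/2) *\<^sub>R mat 1) = (1/2) *\<^sub>R e"
proof -
  have "e - (1/2) *\<^sub>R mat 1 = e + (- 1/2) *\<^sub>R mat 1" by simp
  moreover have "e + (- 1/2) *\<^sub>R e = (1/2) *\<^sub>R e"
    using scaleR_left_distrib[of 1 "- 1/2" e] by simp
  ultimately show "(e - (1/2) *\<^sub>R mat 1) ** e = (1/2) *\<^sub>R e"
    "e ** (e - (1/2) *\<^sub>R mat 1) = (1/2) *\<^sub>R e"
    using assms by (simp_all only: matrix_add_ldistrib matrix_add_rdistrib scalar_matrix_assoc[symmetric] matrix_scalar_ac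
        matrix_mul_lid matrix_mul_rid)
qed

lemma idempotent_of_involution:
  fixes v :: "'a::real_algebra_1^'n^'n"
  assumes "v ** v = mat 1"
  shows "((1/2) *\<^sub>R (mat 1 + v)) ** ((1/2) *\<^sub>R (mat 1 + v)) = (1/2) *\<^sub>R (mat 1 + v)"
proof -
  have "(mat 1 + v) ** (mat 1 + v) = 2 *\<^sub>R (mat 1 + v)"
    using assms by (simp add: matrix_add_ldistrib matrix_add_rdistrib scaleR_2 add.commute)
  then show ?thesis by (simp add: scalar_matrix_assoc[symmetric] matrix_scalar_ac del: scaleR_add_right)
qed

text \<open>Half of \<open>e\<close> from the first face and half from the last add up to \<open>e\<close>; the inner faces subtract
  \<open>e - 1/2\<close> from it. What remains in the first slot is \<open>1/2\<close>.\<close>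

lemma hochschild_b_chern_connes:
  fixes e :: "'a::cstar_algebra^4^4"
  assumes "e ** e = e" "0 < n"
  shows "hochschild_b (chern_connes e n) =
    (1/2) *\<^sub>C matrix_tensor_trace (mat 1 # replicate (2 * n - 1) e)"
proof -
  define m where "m = 2 * n - 1"
  have m: "2 * n = Suc m" "odd m" "0 < m" using assms by (auto simp: m_def)
  define u where "u = e - (1/2) *\<^sub>R mat 1"
  define T where "T M = matrix_tensor_trace (M # replicate m e)" for M
  have T_add: "T (M + N) = T M + T N" for M N
    using trace_add[of 0 "u # replicate m e" M N] by (simp add: T_def)
  have T_scaleR: "T (r *\<^sub>R M) = complex_of_real r *\<^sub>C T M" for r M
    using trace_scaleR[of 0 "u # replicate m e" r M] by (simp add: T_def)
  let ?Ms = "u # replicate (Suc m) e"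
  have first: "matrix_face 0 ?Ms = ((1/2) *\<^sub>R e) # replicate m e"
    using idempotent_shift_mult[OF assms(1)] by (simp add: matrix_face_def u_def)
  have inner: "matrix_face (Suc j) ?Ms = u # replicate m e" if "j < m" for j
  proof -
    have "replicate j e @ e # replicate (m - Suc j) e = replicate m e"
      using that by (metis replicate_Suc replicate_add add_Suc_right le_add_diff_inverse Suc_leI add_Suc)
    moreover have "matrix_face (Suc j) ?Ms = u # replicate j e @ e # replicate (m - Suc j) e"
      using that assms(1) by (simp add: matrix_face_def min_def del: replicate.simps)
    ultimately show ?thesis by simp
  qed
  have "rotate (Suc m) ?Ms = e # u # replicate m e"
    using rotate_append[of "u # replicate m e" "[e]"] by (simp add: replicate_append_same)
  then have last: "matrix_face 0 (rotate (Suc m) ?Ms) = ((1/2) *\<^sub>R e) # replicate m e"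
    using idempotent_shift_mult[OF assms(1)] by (simp add: matrix_face_def u_def)
  have signs: "(\<Sum>j<m. (-1) ^ Suc j *\<^sub>C x) = - x" for x :: "'a red_chain"
  proof -
    obtain k where "m = Suc (2 * k)" using m by (metis oddE Suc_eq_plus1)
    moreover have "(\<Sum>j<Suc (2 * k). (-1) ^ Suc j *\<^sub>C x) = - x"
      by (induction k) simp_all
    ultimately show ?thesis by simp
  qed
  have "hochschild_b (chern_connes e n) =
      (\<Sum>j<Suc m. (-1) ^ j *\<^sub>C matrix_tensor_trace (matrix_face j ?Ms))
      + (-1) ^ Suc m *\<^sub>C matrix_tensor_trace (matrix_face 0 (rotate (Suc m) ?Ms))"
    unfolding chern_connes_def m u_def[symmetric] by (rule hochschild_b_trace) simp_all
  also have "\<dots> = T ((1/2) *\<^sub>R e) - T u + T ((1/2) *\<^sub>R e)"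
    unfolding sum.lessThan_Suc_shift first last using m signs[of "T u"]
    by (simp add: inner T_def del: replicate.simps)
  also have "\<dots> = T ((1/2) *\<^sub>R mat 1)"
  proof -
    have "T u + T ((1/2) *\<^sub>R mat 1) = T ((1/2) *\<^sub>R e) + T ((1/2) *\<^sub>R e)"
      by (simp add: T_add[symmetric] u_def scaleR_left_distrib[symmetric])
    then show ?thesis by (simp add: algebra_simps)
  qed
  finally show ?thesis by (simp add: T_scaleR) (simp add: T_def m_def)
qed

text \<open>After \<open>B\<^sub>0\<close> the matrix \<open>e - 1/2\<close> stands in a reduced slot, where its scalar part vanishes.\<close>

lemma connes_B_chern_connes:
  fixes e :: "'a::cstar_algebra^4^4"
  assumes "0 < n"
  shows "connes_B (chern_connes e n) =
    (1 / of_nat (2 * n)) *\<^sub>C matrix_tensor_trace (mat 1 # replicate (2 * n + 1) e)"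
proof -
  let ?T = "\<lambda>M. matrix_tensor_trace (mat 1 # M # replicate (2 * n) e)"
  have "?T ((e - (1/2) *\<^sub>R mat 1) + (1/2) *\<^sub>R mat 1) =
      ?T (e - (1/2) *\<^sub>R mat 1) + ?T ((1/2) *\<^sub>R mat 1)"
    using trace_add[of 1 "mat 1 # e # replicate (2 * n) e" "e - (1/2) *\<^sub>R mat 1"
        "(1/2) *\<^sub>R mat 1"] by simp
  moreover have "?T ((1/2) *\<^sub>R mat 1) = 0"
    using trace_scaleR[of 1 "mat 1 # e # replicate (2 * n) e" "1/2" "mat 1"]
      trace_mat_1[of 1 "mat 1 # e # replicate (2 * n) e"] by simp
  ultimately have "?T (e - (1/2) *\<^sub>R mat 1) = ?T e" by simp
  then show ?thesis
    unfolding chern_connes_def using assms by (subst connes_B_trace[where m = "2 * n"]) auto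
qed

section \<open>The projection on the quantum sphere\<close>

lemma star_scaleR: "star (r *\<^sub>R x) = r *\<^sub>R star (x :: 'a::cstar_algebra)"
  by (simp add: scaleR_scaleC star_scaleC)

lemma scaleC_diff_left: "(c - d) *\<^sub>C x = c *\<^sub>C x - d *\<^sub>C (x :: 'a::complex_vector)"
  using scaleC_add_left[of "c - d" d x] by simp

text \<open>With entries \<open>\<plusminus>z\<close> on the diagonal and no scalar terms, this matrix has the simpler products and
  traces. Its defining relation to the projection also gives \<open>e - 1/2 = v/2\<close>.\<close>

definition sphere_involution :: "real \<Rightarrow> 'a::cstar_algebra \<Rightarrow> 'a \<Rightarrow> 'a \<Rightarrow> 'a^4^4" where
  "sphere_involution q \<alpha> \<beta> z = 2 *\<^sub>R sphere_projection q \<alpha> \<beta> z - mat 1"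

lemma sphere_involution_entries:
  fixes q :: real and \<alpha> \<beta> z :: "'a::cstar_algebra"
  defines "v \<equiv> sphere_involution q \<alpha> \<beta> z"
  shows "v $ 1 $ 1 = z" "v $ 1 $ 2 = 0" "v $ 1 $ 3 = \<alpha>" "v $ 1 $ 4 = \<beta>"
    "v $ 2 $ 1 = 0" "v $ 2 $ 2 = z" "v $ 2 $ 3 = - q *\<^sub>R star \<beta>" "v $ 2 $ 4 = star \<alpha>"
    "v $ 3 $ 1 = star \<alpha>" "v $ 3 $ 2 = - q *\<^sub>R \<beta>" "v $ 3 $ 3 = - z" "v $ 3 $ 4 = 0"
    "v $ 4 $ 1 = star \<beta>" "v $ 4 $ 2 = \<alpha>" "v $ 4 $ 3 = 0" "v $ 4 $ 4 = - z"
  by (simp_all add: v_def sphere_involution_def sphere_projection_def vector_def mat_def)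

text \<open>The off-diagonal entries of the square vanish by the commutation relations and their adjoints; the
  diagonal ones are \<open>1\<close> by the two sphere relations.\<close>

lemma sphere_involution_square:
  fixes q :: real and \<alpha> \<beta> z :: "'a::cstar_algebra"
  assumes "sphere_relations q \<alpha> \<beta> z"
  shows "sphere_involution q \<alpha> \<beta> z ** sphere_involution q \<alpha> \<beta> z = mat 1"
proof -
  have rels: "\<beta> * \<alpha> = q *\<^sub>R (\<alpha> * \<beta>)" "star \<beta> * \<alpha> = q *\<^sub>R (\<alpha> * star \<beta>)"
    "star \<beta> * \<beta> = \<beta> * star \<beta>" "z * \<alpha> = \<alpha> * z" "z * \<beta> = \<beta> * z" and z: "star z = z"
    and norms: "star \<alpha> * \<alpha> + q\<^sup>2 *\<^sub>R (\<beta> * star \<beta>) + z\<^sup>2 = 1" "\<alpha> * star \<alpha> + \<beta> * star \<beta> + z\<^sup>2 = 1"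
    using assms by (auto simp: sphere_relations_def)
  have adj: "star \<alpha> * star \<beta> = q *\<^sub>R (star \<beta> * star \<alpha>)" "star \<alpha> * \<beta> = q *\<^sub>R (\<beta> * star \<alpha>)"
    "z * star \<alpha> = star \<alpha> * z" "z * star \<beta> = star \<beta> * z"
    using rels[THEN arg_cong[where f = star]] by (simp_all add: star_mult star_scaleR star_star z)
  have sq: "star \<alpha> * \<alpha> = 1 - z * z - (q * q) *\<^sub>R (\<beta> * star \<beta>)" "\<alpha> * star \<alpha> = 1 - z * z - \<beta> * star \<beta>"
    using norms by (simp_all add: algebra_simps power2_eq_square)
  show ?thesis
    by (simp add: vec_eq_iff forall_4 matrix_matrix_mult_def sum_4 mat_def sphere_involution_entries
        rels adj sq algebra_simps)
qed

lemma sphere_projection_eq: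
  "sphere_projection q \<alpha> \<beta> z = (1/2) *\<^sub>R (mat 1 + sphere_involution q \<alpha> \<beta> z)"
  by (simp add: sphere_involution_def)

text \<open>In a reduced slot the projection \<open>(1 + v)/2\<close> is interchangeable with \<open>v/2\<close>.\<close>

lemma trace_half_shift:
  fixes Ms :: "('a::cstar_algebra^4^4) list"
  assumes "0 < k" "k < length Ms"
  shows "matrix_tensor_trace (Ms[k := (1/2) *\<^sub>R (mat 1 + v)]) =
    (1/2) *\<^sub>C matrix_tensor_trace (Ms[k := v])"
  using assms by (simp add: trace_scaleR trace_add trace_mat_1 del: scaleR_add_right)

lemma reduced_trace_projection_1:
  fixes q :: real and \<alpha> \<beta> z :: "'a::cstar_algebra"
  shows "matrix_tensor_trace [mat 1, sphere_projection q \<alpha> \<beta> z] = 0"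
proof -
  let ?v = "sphere_involution q \<alpha> \<beta> z"
  have e: "sphere_projection q \<alpha> \<beta> z = (1/2) *\<^sub>R (mat 1 + ?v)"
    by (simp add: sphere_involution_def)
  have neg: "tensor [1, - z] = - tensor [1, z]"
    using tensor_scaleC[of 1 "[1, z]" "-1" z] by simp
  have "matrix_tensor_trace [mat 1, ?v] = 0"
    by (simp add: trace_mat_1_Cons sum_lists_Cons sum_4 sphere_involution_entries
        cyclic_entries_def neg)
  then show ?thesis
    using trace_half_shift[of 1 "[mat 1, mat 1]" ?v] by (simp add: e del: scaleR_add_right)
qed

text \<open>Up to the factor \<open>1/8\<close> this is the sum over closed walks \<open>i, j, k\<close> of the tensors
  \<open>1 \<otimes> v\<^sub>i\<^sub>j \<otimes> v\<^sub>j\<^sub>k \<otimes> v\<^sub>k\<^sub>i\<close>. In blocks, \<open>v\<close> has \<open>z\<close> and \<open>- z\<close> on the diagonal and \<open>X\<close>, \<open>X\<^sup>*\<close> off it. A walk takes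
  three diagonal steps, and then the two signs cancel, or one diagonal step \<open>\<plusminus>z\<close> together with \<open>X\<close> and
  \<open>X\<^sup>*\<close>. The sign of the diagonal step antisymmetrizes in \<open>X\<close> and \<open>X\<^sup>*\<close>: the entries \<open>\<alpha>\<close> and \<open>\<alpha>\<^sup>*\<close> cancel,
  whereas \<open>\<beta>\<close> and \<open>- q \<beta>\<^sup>*\<close> leave \<open>1 - q\<^sup>2\<close>.\<close>

lemma reduced_trace_projection_3:
  fixes q :: real and \<alpha> \<beta> z :: "'a::cstar_algebra"
  defines "e \<equiv> sphere_projection q \<alpha> \<beta> z"
  shows "matrix_tensor_trace [mat 1, e, e, e] =
      complex_of_real (1/8 * (1 - q\<^sup>2)) *\<^sub>C
        ((tensor [1, z, \<beta>, star \<beta>] - tensor [1, z, star \<beta>, \<beta>])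
         + (tensor [1, \<beta>, star \<beta>, z] - tensor [1, \<beta>, z, star \<beta>])
         + (tensor [1, star \<beta>, z, \<beta>] - tensor [1, star \<beta>, \<beta>, z]))" (is "_ = _ *\<^sub>C ?X")
proof -
  define v where "v = sphere_involution q \<alpha> \<beta> z"
  have e: "e = (1/2) *\<^sub>R (mat 1 + v)"
    by (simp add: v_def e_def sphere_involution_def)
  define F where "F x y w = tensor [1, x, y, w]" for x y w :: 'a
  have scale: "F (c *\<^sub>C x) y w = c *\<^sub>C F x y w" "F x (c *\<^sub>C y) w = c *\<^sub>C F x y w"
    "F x y (c *\<^sub>C w) = c *\<^sub>C F x y w" for c x y w
    using tensor_scaleC[of 1 "[1, x, y, w]" c x] tensor_scaleC[of 2 "[1, x, y, w]" c y]
      tensor_scaleC[of 3 "[1, x, y, w]" c w] by (simp_all add: F_def)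
  have zero: "F 0 y w = 0" "F x 0 w = 0" "F x y 0 = 0" for x y w
    using scale(1)[of 0] scale(2)[of _ 0] scale(3)[of _ _ 0] by simp_all
  have neg: "F (- x) y w = - F x y w" "F x (- y) w = - F x y w" "F x y (- w) = - F x y w" for x y w
    using scale(1)[of "-1"] scale(2)[of _ "-1"] scale(3)[of _ _ "-1"] by simp_all
  have scaleR: "F (r *\<^sub>R x) y w = complex_of_real r *\<^sub>C F x y w"
    "F x (r *\<^sub>R y) w = complex_of_real r *\<^sub>C F x y w"
    "F x y (r *\<^sub>R w) = complex_of_real r *\<^sub>C F x y w" for r x y w
    by (simp_all add: scaleR_scaleC scale)
  have "matrix_tensor_trace [mat 1, v, v, v] =
      (\<Sum>k\<in>UNIV. \<Sum>j\<in>UNIV. \<Sum>i\<in>UNIV. F (v $ i $ j) (v $ j $ k) (v $ k $ i))"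
    by (simp add: trace_mat_1_Cons sum_lists_Cons cyclic_entries_def F_def numeral_2_eq_2)
  also have "\<dots> = complex_of_real (1 - q\<^sup>2) *\<^sub>C ?X"
    unfolding F_def[symmetric] sum_4
    by (simp add: v_def sphere_involution_entries zero neg scaleR power2_eq_square
        scaleC_diff_left scaleC_diff_right scaleC_add_right)
  finally have v: "matrix_tensor_trace [mat 1, v, v, v] = complex_of_real (1 - q\<^sup>2) *\<^sub>C ?X" .
  have "matrix_tensor_trace [mat 1, e, e, e] = (1/2) *\<^sub>C (1/2) *\<^sub>C (1/2) *\<^sub>C matrix_tensor_trace [mat 1, v, v, v]"
    using trace_half_shift[of 1 "[mat 1, e, e, e]" v] trace_half_shift[of 2 "[mat 1, v, e, e]" v]
      trace_half_shift[of 3 "[mat 1, v, v, e]" v]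
    by (simp add: e[symmetric] del: scaleR_add_right scaleC_scaleC)
  then show ?thesis by (simp add: v)
qed

lemma chern_connes_sphere_0:
  fixes q :: real and \<alpha> \<beta> z :: "'a::cstar_algebra"
  shows "chern_connes (sphere_projection q \<alpha> \<beta> z) 0 = 0"
proof -
  let ?v = "sphere_involution q \<alpha> \<beta> z"
  have e: "sphere_projection q \<alpha> \<beta> z - (1/2) *\<^sub>R mat 1 = (1/2) *\<^sub>R ?v"
    by (simp add: sphere_involution_def scaleR_diff_right)
  have neg: "tensor [- z] = - tensor [z]"
    using tensor_scaleC[of 0 "[z]" "-1" z] by simp
  have "matrix_tensor_trace [?v] = 0"
    by (simp add: matrix_tensor_trace_eq sum_lists_Cons sum_4 sphere_involution_entries cyclic_entries_def neg)
  then show ?thesis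
    using trace_scaleR[of 0 "[?v]" "1/2" ?v] by (simp add: chern_connes_def e)
qed

theorem mainTheorem3:
  fixes q :: real and \<alpha> \<beta> z :: "'a::cstar_algebra" and e :: "'a^4^4"
  assumes "q \<in> {-1..<0} \<union> {0<..1}"
    and "universal_sphere_algebra q \<alpha> \<beta> z"
    and "e = sphere_projection q \<alpha> \<beta> z"
  shows "hochschild_b (chern_connes e 1) = 0 \<and>
    connes_B (chern_connes e 0) = 0 \<and>
    hochschild_b (chern_connes e 2) =
      complex_of_real (1/16 * (1 - q\<^sup>2)) *\<^sub>C
        ((tensor [1, z, \<beta>, star \<beta>] - tensor [1, z, star \<beta>, \<beta>])
         + (tensor [1, \<beta>, star \<beta>, z] - tensor [1, \<beta>, z, star \<beta>])
         + (tensor [1, star \<beta>, z, \<beta>] - tensor [1, star \<beta>, \<beta>, z])) \<and>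
    hochschild_b (chern_connes e 2) = connes_B (chern_connes e 1) \<and>
    bB_cycle 2 ((\<lambda>_. 0)(1 := chern_connes e 1, 2 := chern_connes e 2))"
proof -
  have rel: "sphere_relations q \<alpha> \<beta> z"
    using assms(2) by (simp add: universal_sphere_algebra_def)
  have idem: "e ** e = e"
    using idempotent_of_involution[OF sphere_involution_square[OF rel]] assms(3)
    by (simp only: sphere_projection_eq)
  have repl: "replicate (2 * 1 - 1) e = [e]"
    "replicate (2 * 2 - 1) e = [e, e, e]" "replicate (2 * 1 + 1) e = [e, e, e]"
    by (simp_all add: numeral_3_eq_3)
  have b1: "hochschild_b (chern_connes e 1) = 0"
    using hochschild_b_chern_connes[OF idem, of 1] reduced_trace_projection_1[of q \<alpha> \<beta> z] assms(3) by simp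
  have b2: "hochschild_b (chern_connes e 2) = (1/2) *\<^sub>C matrix_tensor_trace [mat 1, e, e, e]"
    using hochschild_b_chern_connes[OF idem, of 2] unfolding repl by simp
  have B0: "connes_B (chern_connes e 0) = 0"
    by (simp add: assms(3) chern_connes_sphere_0 connes_B_def extend_zero connes_tensor_multilinear)
  have B1: "connes_B (chern_connes e 1) = (1/2) *\<^sub>C matrix_tensor_trace [mat 1, e, e, e]"
    using connes_B_chern_connes[of 1 e] unfolding repl by simp
  have "hochschild_b (chern_connes e 2) =
      complex_of_real (1/16 * (1 - q\<^sup>2)) *\<^sub>C
        ((tensor [1, z, \<beta>, star \<beta>] - tensor [1, z, star \<beta>, \<beta>])
         + (tensor [1, \<beta>, star \<beta>, z] - tensor [1, \<beta>, z, star \<beta>])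
         + (tensor [1, star \<beta>, z, \<beta>] - tensor [1, star \<beta>, \<beta>, z]))"
    unfolding b2 unfolding assms(3) reduced_trace_projection_3 by simp
  moreover have "bB_cycle 2 ((\<lambda>_. 0)(1 := chern_connes e 1, 2 := chern_connes e 2))"
  proof -
    have zero: "hochschild_b (0 :: 'a red_chain) = 0" "connes_B (0 :: 'a red_chain) = 0"
      by (simp_all add: hochschild_b_def connes_B_def extend_zero hochschild_tensor_multilinear
          connes_tensor_multilinear)
    have "chern_connes e n \<in> red_chains (2 * n)" for n
      unfolding chern_connes_def by (rule trace_in_red_chains) simp
    from this[of 1] this[of 2] show ?thesis
      using b1 b2 B1 zero
      by (auto simp: bB_cycle_def red_chains.intros(1) numeral_2_eq_2 less_Suc_eq le_Suc_eq)
  qed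
  ultimately show ?thesis using b1 b2 B0 B1 by simp
qed

end
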